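(* Let $w_1,w_2,w_3$ be any odd positive integers. Then for every integer $n\ge 0$ and every $y_1\in\mathbb{Z}_p$, the following six expressions are equal: \begin{align*} &w_1^n\sum_{k=0}^{n}\binom{n}{k}\sum_{a=0}^{w_1d-1}(-1)^a\chi(a)E_{k,\chi}\Big(w_2y_1+\frac{w_2}{w_1}a\Big)T_{n-k}(w_3d-1,\chi)w_2^{n-k}w_3^k\\ =&w_1^n\sum_{k=0}^{n}\binom{n}{k}\sum_{a=0}^{w_1d-1}(-1)^a\chi(a)E_{k,\chi}\Big(w_3y_1+\frac{w_3}{w_1}a\Big)T_{n-k}(w_2d-1,\chi)w_3^{n-k}w_2^k\\ =&w_2^n\sum_{k=0}^{n}\binom{n}{k}\sum_{a=0}^{w_2d-1}(-1)^a\chi(a)E_{k,\chi}\Big(w_1y_1+\frac{w_1}{w_2}a\Big)T_{n-k}(w_3d-1,\chi)w_1^{n-k}w_3^k\\ =&w_2^n\sum_{k=0}^{n}\binom{n}{k}\sum_{a=0}^{w_2d-1}(-1)^a\chi(a)E_{k,\chi}\Big(w_3y_1+\frac{w_3}{w_2}a\Big)T_{n-k}(w_1d-1,\chi)w_3^{n-k}w_1^k\\ =&w_3^n\sum_{k=0}^{n}\binom{n}{k}\sum_{a=0}^{w_3d-1}(-1)^a\chi(a)E_{k,\chi}\Big(w_1y_1+\frac{w_1}{w_3}a\Big)T_{n-k}(w_2d-1,\chi)w_1^{n-k}w_2^k\\ =&w_3^n\sum_{k=0}^{n}\binom{n}{k}\sum_{a=0}^{w_3d-1}(-1)^a\chi(a)E_{k,\chi}\Big(w_2y_1+\frac{w_2}{w_3}a\Big)T_{n-k}(w_1d-1,\chi)w_2^{n-k}w_1^k.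 \end{align*}
   Context: $p$ is a fixed odd prime, $\mathbb{Z}_p$ is the ring of $p$-adic integers, and $\mathbb{C}_p$ is the completion of an algebraic closure of $\mathbb{Q}_p$. $d$ is a fixed odd positive integer and $\chi$ is a (primitive) Dirichlet character of conductor $d$, with values in $\overline{\mathbb{Q}}$, regarded as $\mathbb{C}_p$-valued through a fixed embedding $\overline{\mathbb{Q}}\to\mathbb{C}_p$; as usual $\chi(a)=0$ when $\gcd(a,d)>1$ (and $\chi\equiv 1$ if $d=1$). The generalized Euler polynomials $E_{n,\chi}(x)$ attached to $\chi$ are the polynomials in $x$ (with coefficients in $\mathbb{C}_p$, so they can be evaluated at any element of $\mathbb{C}_p$) defined by $$\frac{2e^{xt}}{e^{dt}+1}\sum_{a=0}^{d-1}(-1)^a\chi(a)e^{at}=\sum_{n=0}^{\infty}E_{n,\chi}(x)\frac{t^n}{n!}.$$ For integers $k,n\ge 0$, the $k$th alternating generalized power sum attached to $\chi$ is $T_k(n,\chi)=\sum_{a=0}^{n}(-1)^a\chi(a)a^k$, with the convention $0^0=1$. *)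

theory Defs
  imports "HOL-Analysis.Analysis" "HOL-Computational_Algebra.Computational_Algebra"
    "HOL-Number_Theory.Cong"
begin

subsection \<open>The field of p-adic complex numbers\<close>

text \<open>
  The p-adic fields are described inside a field that is also a complete metric space; the
  p-adic absolute value of x is \<^term>\<open>dist x 0\<close>.

  Completing a metric field means embedding it densely into a complete one.  Hence the closure
  of the rationals in a complete field whose absolute value extends the p-adic one is
  the field of p-adic numbers, and a complete field in which an algebraic closure of that field
  is dense is a completion of this algebraic closure.
\<close>

definition padic_numbers :: "'a::{field_char_0, complete_space} set" where
  "padic_numbers = closure \<rat>"

definition padic_integers :: "'a::{field_char_0, complete_space} set" where
  "padic_integers = {x \<in> padic_numbers. dist x 0 \<le> 1}"

definition padic_algebraic :: "'a::{field_char_0, complete_space} set" where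
  "padic_algebraic =
     {x. \<exists>f. f \<noteq> 0 \<and> (\<forall>i. coeff f i \<in> padic_numbers) \<and> poly f x = 0}"

text \<open>
  The metric comes from an absolute value that restricts to the normalised p-adic one on the
  integers (hence on the rationals; it is then non-archimedean), the elements algebraic over
  the p-adic numbers form an algebraically closed field, and they are dense.  Completeness is
  part of the type class.
\<close>

definition padic_complex_field :: "nat \<Rightarrow> 'a::{field_char_0, complete_space} itself \<Rightarrow> bool" where
  "padic_complex_field p _ \<longleftrightarrow>
     (\<forall>x y z :: 'a. dist (x + z) (y + z) = dist x y) \<and>
     (\<forall>x y :: 'a. dist (x * y) 0 = dist x 0 * dist y 0) \<and>
     (\<forall>m :: int. m \<noteq> 0 \<longrightarrow> dist (of_int m :: 'a) 0 = (1 / real p) ^ multiplicity (int p) m) \<and>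
     (\<forall>f :: 'a poly. degree f > 0 \<and> (\<forall>i. coeff f i \<in> padic_algebraic)
        \<longrightarrow> (\<exists>x\<in>padic_algebraic. poly f x = 0)) \<and>
     closure (padic_algebraic :: 'a set) = UNIV"


subsection \<open>Primitive Dirichlet characters\<close>

definition dirichlet_character :: "nat \<Rightarrow> (int \<Rightarrow> complex) \<Rightarrow> bool" where
  "dirichlet_character d chi \<longleftrightarrow>
     d > 0 \<and>
     chi 1 = 1 \<and>
     (\<forall>a b. chi (a * b) = chi a * chi b) \<and>
     (\<forall>a. chi (a + int d) = chi a) \<and>
     (\<forall>a. chi a = 0 \<longleftrightarrow> \<not> coprime a (int d))"

text \<open>
  The conductor of a character modulo d is d itself iff no proper divisor m of d is an induced
  modulus, i.e. iff the character is nontrivial on the units congruent to 1 modulo m.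
\<close>

definition primitive_dirichlet_character :: "nat \<Rightarrow> (int \<Rightarrow> complex) \<Rightarrow> bool" where
  "primitive_dirichlet_character d chi \<longleftrightarrow>
     dirichlet_character d chi \<and>
     (\<forall>m. m dvd d \<and> m \<noteq> d \<longrightarrow>
        (\<exists>a. coprime a (int d) \<and> [a = 1] (mod int m) \<and> chi a \<noteq> 1))"

text \<open>The algebraic closure of the rationals is taken to be the set of algebraic complex numbers.\<close>

definition algebraic_embedding :: "(complex \<Rightarrow> 'a::field_char_0) \<Rightarrow> bool" where
  "algebraic_embedding \<iota> \<longleftrightarrow>
     \<iota> 1 = 1 \<and>
     (\<forall>x y. algebraic x \<and> algebraic y \<longrightarrow> \<iota> (x + y) = \<iota> x + \<iota> y \<and> \<iota> (x * y) = \<iota> x * \<iota> y) \<and>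
     inj_on \<iota> {x. algebraic x}"


subsection \<open>Generalized Euler polynomials and alternating power sums\<close>

text \<open>The generating series at x = 0; the denominator has constant coefficient 2.\<close>

definition gen_euler_series0 :: "nat \<Rightarrow> (int \<Rightarrow> 'a::field_char_0) \<Rightarrow> 'a fps" where
  "gen_euler_series0 d chi =
     fps_const 2 / (fps_exp (of_nat d) + 1) *
     (\<Sum>a = 0..d-1. fps_const ((-1) ^ a * chi (int a)) * fps_exp (of_nat a))"

text \<open>
  The full generating series as a power series in t over the polynomials in x.  The first factor
  is exp (x t), whose coefficient of t^n is the polynomial x^n / n!.
\<close>

definition gen_euler_series :: "nat \<Rightarrow> (int \<Rightarrow> 'a::field_char_0) \<Rightarrow> 'a poly fps" where
  "gen_euler_series d chi =
     Abs_fps (\<lambda>n. monom (1 / fact n) n) *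
     Abs_fps (\<lambda>n. [:fps_nth (gen_euler_series0 d chi) n:])"

definition gen_euler_poly :: "nat \<Rightarrow> (int \<Rightarrow> 'a::field_char_0) \<Rightarrow> nat \<Rightarrow> 'a poly" where
  "gen_euler_poly d chi n = smult (fact n) (fps_nth (gen_euler_series d chi) n)"

lemma gen_euler_poly_generating_function:
  "Abs_fps (\<lambda>n. poly (gen_euler_poly d chi n) x / fact n) =
     fps_const 2 * fps_exp x / (fps_exp (of_nat d) + 1) *
     (\<Sum>a = 0..d-1. fps_const ((-1) ^ a * chi (int a)) * fps_exp (of_nat a))"
proof -
  have "Abs_fps (\<lambda>n. poly (gen_euler_poly d chi n) x / fact n) = fps_exp x * gen_euler_series0 d chi"
    by (rule fps_ext)
       (simp add: gen_euler_poly_def gen_euler_series_def fps_mult_nth poly_sum poly_monom mult.commute)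
  moreover have "fps_nth (fps_exp (of_nat d) + 1 :: 'a fps) 0 \<noteq> 0"
    by simp
  ultimately show ?thesis
    by (simp add: gen_euler_series0_def fps_divide_unit mult_ac)
qed

definition alt_power_sum :: "nat \<Rightarrow> nat \<Rightarrow> (int \<Rightarrow> 'a::field_char_0) \<Rightarrow> 'a" where
  "alt_power_sum k n chi = (\<Sum>a = 0..n. (-1) ^ a * chi (int a) * of_nat a ^ k)"

end

theory Submission
  imports Defs
begin

text \<open>
  Put $P_m(c) = \sum_{a<m} (-1)^a \chi(a) e^{act}$. The expression with parameters $(u,v,w)$ is
  $n!$ times the coefficient of $t^n$ in
  $$\frac{2e^{uvwyt}}{e^{duwt}+1}\, P_d(uw)\, P_{ud}(vw)\, P_{wd}(uv).$$
  Since $\chi$ has period $d$ and $d, u$ are odd, summing a geometric series gives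
  $P_{ud}(c) = P_d(c)\,(e^{udct}+1)/(e^{dct}+1)$. The series therefore equals
  $$\frac{2e^{uvwyt}\,(e^{duvwt}+1)^2}{(e^{duwt}+1)(e^{dvwt}+1)(e^{duvt}+1)}\,
    P_d(uw)\,P_d(vw)\,P_d(uv),$$
  which is symmetric in $u, v, w$.
\<close>

text \<open>This is $P_m(c)$. Summing over \<open>a < m\<close> makes the sum empty for
  \<open>m = 0\<close>, which starts the induction over blocks; a range \<open>0..m - 1\<close>
  would not.\<close>

definition alt_exp_sum :: "(int \<Rightarrow> 'a::field_char_0) \<Rightarrow> nat \<Rightarrow> 'a \<Rightarrow> 'a fps" where
  "alt_exp_sum chi m c =
     (\<Sum>a<m. fps_const ((-1) ^ a * chi (int a)) * fps_exp (c * of_nat a))"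

text \<open>Makes $P_m(c)$ the exponential generating function of the power sums $T_k$. With
  \<open>m = 0\<close> truncated subtraction would leave the term \<open>a = 0\<close> on the right
  only.\<close>

lemma alt_exp_sum_nth:
  assumes "m > 0"
  shows "fps_nth (alt_exp_sum chi m c) k = c ^ k * alt_power_sum k (m - 1) chi / fact k"
proof -
  have "{0..m - 1} = {..<m}"
    using assms by auto
  then show ?thesis
    by (simp add: alt_exp_sum_def alt_power_sum_def fps_sum_nth sum_distrib_left
        sum_divide_distrib power_mult_distrib mult_ac)
qed

text \<open>Cut the range \<open>a < u * d\<close> into \<open>u\<close> blocks of length
  \<open>d\<close>. Each block is \<open>?q\<close> times the preceding one, so a geometric series
  factors out. The denominator is cleared to avoid division of power series.\<close>

lemma alt_exp_sum_mult:
  assumes per: "\<And>a. chi (a + int d) = chi a" and "odd d" and "odd u"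
  shows "(fps_exp (of_nat d * c) + 1) * alt_exp_sum chi (u * d) c =
         (fps_exp (of_nat u * of_nat d * c) + 1) * alt_exp_sum chi d c"
proof -
  let ?q = "- fps_exp (of_nat d * c) :: 'a fps"
  have per_mult: "chi (a + int (j * d)) = chi a" for a j
  proof (induction j)
    case (Suc j)
    then show ?case
      using per[of "a + int (j * d)"] by (simp add: algebra_simps)
  qed simp
  have block: "alt_exp_sum chi (j * d) c = (\<Sum>i<j. ?q ^ i) * alt_exp_sum chi d c" for j
  proof (induction j)
    case 0
    then show ?case by (simp add: alt_exp_sum_def)
  next
    case (Suc j)
    \<comment> \<open>The sign of \<open>?q\<close> comes from \<open>d\<close> being odd: moving
      \<open>j\<close> blocks changes the sign by $(-1)^{jd} = (-1)^j$.\<close>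
    have shift: "fps_const ((-1) ^ (a + j * d) * chi (int (a + j * d))) *
            fps_exp (c * of_nat (a + j * d)) =
          ?q ^ j * (fps_const ((-1) ^ a * chi (int a)) * fps_exp (c * of_nat a))" for a
    proof -
      have "(-1 :: 'a) ^ (a + j * d) = (-1) ^ j * (-1) ^ a"
        using \<open>odd d\<close> by (simp add: power_add mult.commute[of j] power_mult)
      moreover have "fps_exp (c * of_nat (a + j * d)) =
          fps_exp (of_nat d * c) ^ j * fps_exp (c * of_nat a)"
        by (simp add: fps_exp_power_mult fps_exp_add_mult[symmetric] algebra_simps)
      moreover have "?q ^ j = fps_const ((-1) ^ j) * fps_exp (of_nat d * c) ^ j"
        by (subst power_minus) (simp flip: fps_const_power fps_const_neg)
      moreover have "chi (int (a + j * d)) = chi (int a)"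
        using per_mult[of "int a" j] by simp
      ultimately show ?thesis
        by (simp only: fps_const_mult[symmetric] mult_ac)
    qed
    \<comment> \<open>Split off the last block and reindex it to start at 0.\<close>
    have "alt_exp_sum chi (Suc j * d) c = alt_exp_sum chi (j * d) c +
        (\<Sum>a<d. fps_const ((-1) ^ (a + j * d) * chi (int (a + j * d))) *
            fps_exp (c * of_nat (a + j * d)))"
      unfolding alt_exp_sum_def lessThan_atLeast0
      by (subst sum.atLeastLessThan_concat[of 0 "j * d" "Suc j * d", symmetric])
        (simp_all add: sum.shift_bounds_nat_ivl[of _ 0 "j * d" d, simplified] add.commute)
    also have "\<dots> = (\<Sum>i<Suc j. ?q ^ i) * alt_exp_sum chi d c"
      unfolding shift Suc.IH sum_distrib_left[symmetric] alt_exp_sum_def[symmetric]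
      by (simp only: sum.lessThan_Suc distrib_right)
    finally show ?case .
  qed
  have "(1 - ?q) * (\<Sum>i<u. ?q ^ i) = 1 - ?q ^ u"
    by (simp only: one_diff_power_eq)
  \<comment> \<open>Oddness of \<open>u\<close> turns $1 - q^u$ into the sum of 1 and an
    exponential.\<close>
  also have "?q ^ u = - fps_exp (of_nat u * of_nat d * c)"
    using \<open>odd u\<close> by (simp add: fps_exp_power_mult mult.assoc)
  finally have "(fps_exp (of_nat d * c) + 1) * (\<Sum>i<u. ?q ^ i) =
      fps_exp (of_nat u * of_nat d * c) + 1"
    by (simp add: add.commute)
  then show ?thesis
    unfolding block by (simp only: mult.assoc[symmetric])
qed

text \<open>The defining generating function with $t$ replaced by $ct$ and the denominator
  cleared.\<close>

lemma gen_euler_poly_egf_scaled: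
  fixes chi :: "int \<Rightarrow> 'a::field_char_0"
  assumes "d > 0"
  shows "(fps_exp (of_nat d * c) + 1) *
           Abs_fps (\<lambda>k. poly (gen_euler_poly d chi k) x * c ^ k / fact k) =
         fps_const 2 * fps_exp (x * c) * alt_exp_sum chi d c"
proof -
  let ?E = "Abs_fps (\<lambda>k. poly (gen_euler_poly d chi k) x / fact k)"
  let ?D = "fps_exp (of_nat d) + 1 :: 'a fps"
  \<comment> \<open>The substitution is composition with $ct$, which respects products because this
    series has constant coefficient 0.\<close>
  let ?s = "fps_const c * fps_X :: 'a fps"
  have D: "fps_nth ?D 0 \<noteq> 0"
    by simp
  have I: "{0..d - 1} = {..<d}"
    using assms by auto
  have "?D * ?E = fps_const 2 * fps_exp x * alt_exp_sum chi d 1"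
    unfolding gen_euler_poly_generating_function I alt_exp_sum_def
    using D inverse_mult_eq_1'[OF D] by (simp add: fps_divide_unit mult_ac)
  then have "(?D * ?E) oo ?s = (fps_const 2 * fps_exp x * alt_exp_sum chi d 1) oo ?s"
    by simp
  then have "(?D oo ?s) * (?E oo ?s) =
      fps_const 2 * (fps_exp x oo ?s) * (alt_exp_sum chi d 1 oo ?s)"
    by (simp add: fps_compose_mult_distrib)
  moreover have "?D oo ?s = fps_exp (of_nat d * c) + 1"
    by (simp add: fps_compose_add_distrib fps_exp_compose_linear mult.commute[of c])
  moreover have "?E oo ?s = Abs_fps (\<lambda>k. poly (gen_euler_poly d chi k) x * c ^ k / fact k)"
    by (rule fps_ext) (simp add: fps_compose_linear)
  moreover have "alt_exp_sum chi d 1 oo ?s = alt_exp_sum chi d c"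
    by (simp add: alt_exp_sum_def fps_compose_sum_distrib fps_compose_mult_distrib
        fps_exp_compose_linear mult.commute[of c])
  ultimately show ?thesis
    by (simp add: fps_exp_compose_linear)
qed

text \<open>The Euler factor is taken at $uwt$ and the power sum factor at $uvt$, because $(uw)^k
  (uv)^{n-k} = u^n v^{n-k} w^k$ is the weight in the theorem.\<close>

definition euler_sum_product ::
  "nat \<Rightarrow> (int \<Rightarrow> 'a::field_char_0) \<Rightarrow> 'a \<Rightarrow> nat \<Rightarrow> nat \<Rightarrow> nat \<Rightarrow> 'a fps" where
  "euler_sum_product d chi y u v w =
     (\<Sum>a<u * d. fps_const ((-1) ^ a * chi (int a)) *
        Abs_fps (\<lambda>k. poly (gen_euler_poly d chi k)
          (of_nat v * y + of_nat v / of_nat u * of_nat a) * (of_nat u * of_nat w) ^ k / fact k)) *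
     alt_exp_sum chi (w * d) (of_nat u * of_nat v)"

text \<open>A product of exponential generating functions is a binomial convolution:
  \<open>fact n\<close> absorbs the two factorials into \<open>n choose k\<close>.\<close>

lemma fact_mult_euler_sum_product_nth:
  assumes "d > 0" and "u > 0" and "w > 0"
  shows "fact n * fps_nth (euler_sum_product d chi y u v w) n =
    of_nat u ^ n *
      (\<Sum>k = 0..n. of_nat (n choose k) *
        (\<Sum>a = 0..u * d - 1. (-1) ^ a * chi (int a) *
           poly (gen_euler_poly d chi k) (of_nat v * y + of_nat v / of_nat u * of_nat a)) *
        alt_power_sum (n - k) (w * d - 1) chi * of_nat v ^ (n - k) * of_nat w ^ k)"
proof -
  have "{0..m - 1} = {..<m}" if "m > 0" for m :: nat
    using that by auto
  then have I: "{0..u * d - 1} = {..<u * d}"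
    using assms by simp
  have wd: "w * d > 0"
    using assms by simp
  have *: "fact n * ((\<Sum>a<u * d. f a * (of_nat u * of_nat w) ^ k / fact k) *
        ((of_nat u * of_nat v) ^ (n - k) * T / fact (n - k))) =
      of_nat u ^ n * (of_nat (n choose k) * (\<Sum>a<u * d. f a) * T * of_nat v ^ (n - k) * of_nat w ^ k)"
    if "k \<le> n" for k T and f :: "nat \<Rightarrow> 'a"
  proof -
    have "(of_nat u :: 'a) ^ n = of_nat u ^ k * of_nat u ^ (n - k)"
      using that by (simp flip: power_add)
    then show ?thesis
      using that
      by (simp add: binomial_fact power_mult_distrib field_simps
          flip: sum_divide_distrib sum_distrib_right sum_distrib_left)
  qed
  let ?f = "\<lambda>k a. (-1) ^ a * chi (int a) *
      poly (gen_euler_poly d chi k) (of_nat v * y + of_nat v / of_nat u * of_nat a)"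
  have "fact n * fps_nth (euler_sum_product d chi y u v w) n =
      (\<Sum>k = 0..n. fact n * ((\<Sum>a<u * d. ?f k a * (of_nat u * of_nat w) ^ k / fact k) *
        ((of_nat u * of_nat v) ^ (n - k) * alt_power_sum (n - k) (w * d - 1) chi / fact (n - k))))"
    unfolding euler_sum_product_def fps_mult_nth sum_distrib_left[of "fact n"]
    by (simp add: fps_sum_nth alt_exp_sum_nth[OF wd] mult.assoc)
  also have "\<dots> = (\<Sum>k = 0..n. of_nat u ^ n * (of_nat (n choose k) * (\<Sum>a<u * d. ?f k a) *
      alt_power_sum (n - k) (w * d - 1) chi * of_nat v ^ (n - k) * of_nat w ^ k))"
    by (intro sum.cong refl *) simp
  finally show ?thesis
    unfolding I sum_distrib_left[of "of_nat u ^ n"] .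
qed

text \<open>The closed form with its three denominators moved to the left. Both the multiplier and
  the right-hand side are invariant under permuting \<open>u\<close>, \<open>v\<close>,
  \<open>w\<close>.\<close>

lemma euler_sum_product_symmetric_form:
  fixes chi :: "int \<Rightarrow> 'a::field_char_0" and y :: 'a
  assumes per: "\<And>a. chi (a + int d) = chi a" and "odd d" and "odd u" and "odd w"
  defines "D \<equiv> \<lambda>c :: 'a. fps_exp (of_nat d * c) + 1"
    and "P \<equiv> alt_exp_sum chi d"
  shows "D (of_nat u * of_nat v) * D (of_nat u * of_nat w) * D (of_nat v * of_nat w) *
           euler_sum_product d chi y u v w =
         fps_const 2 * fps_exp (of_nat u * of_nat v * of_nat w * y) *
           D (of_nat u * of_nat v * of_nat w) ^ 2 *
           (P (of_nat u * of_nat v) * P (of_nat u * of_nat w) * P (of_nat v * of_nat w))"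
proof -
  let ?u = "of_nat u :: 'a" and ?v = "of_nat v :: 'a" and ?w = "of_nat w :: 'a"
  let ?x = "\<lambda>a. ?v * y + ?v / ?u * of_nat a"
  let ?H = "\<Sum>a<u * d. fps_const ((-1) ^ a * chi (int a)) *
        Abs_fps (\<lambda>k. poly (gen_euler_poly d chi k) (?x a) * (?u * ?w) ^ k / fact k)"
  have pos: "d > 0" "u > 0"
    using assms by (auto elim: oddE)
  have exp_split: "fps_exp (?x a * (?u * ?w)) =
      fps_exp (?u * ?v * ?w * y) * fps_exp (?v * ?w * of_nat a)" for a :: nat
    using pos by (simp add: fps_exp_add_mult[symmetric] field_simps)
  \<comment> \<open>The factor \<open>D (?u * ?w)\<close> does not depend on \<open>a\<close>, so it
    clears the denominator of every summand at once.\<close>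
  have "D (?u * ?w) * ?H =
      (\<Sum>a<u * d. fps_const ((-1) ^ a * chi (int a)) *
         (fps_const 2 * fps_exp (?x a * (?u * ?w)) * P (?u * ?w)))"
    unfolding D_def P_def gen_euler_poly_egf_scaled[OF pos(1), symmetric]
    by (simp add: sum_distrib_left mult_ac)
  also have "\<dots> = fps_const 2 * fps_exp (?u * ?v * ?w * y) * P (?u * ?w) *
      alt_exp_sum chi (u * d) (?v * ?w)"
    unfolding exp_split alt_exp_sum_def sum_distrib_left by (simp only: mult_ac)
  finally have 1: "D (?u * ?w) * ?H = \<dots>" .
  \<comment> \<open>This and the next fact contribute one factor \<open>D (?u * ?v * ?w)\<close>
    each, hence the square.\<close>
  have 2: "D (?v * ?w) * alt_exp_sum chi (u * d) (?v * ?w) = D (?u * ?v * ?w) * P (?v * ?w)"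
    using alt_exp_sum_mult[of chi d u "?v * ?w", OF per \<open>odd d\<close> \<open>odd u\<close>]
    by (simp add: D_def P_def mult_ac)
  have 3: "D (?u * ?v) * alt_exp_sum chi (w * d) (?u * ?v) = D (?u * ?v * ?w) * P (?u * ?v)"
    using alt_exp_sum_mult[of chi d w "?u * ?v", OF per \<open>odd d\<close> \<open>odd w\<close>]
    by (simp add: D_def P_def mult_ac)
  have "D (?u * ?v) * D (?u * ?w) * D (?v * ?w) * euler_sum_product d chi y u v w =
      D (?v * ?w) * (D (?u * ?w) * ?H) * (D (?u * ?v) * alt_exp_sum chi (w * d) (?u * ?v))"
    unfolding euler_sum_product_def by (simp only: mult_ac)
  also have "\<dots> = fps_const 2 * fps_exp (?u * ?v * ?w * y) * P (?u * ?w) *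
      (D (?v * ?w) * alt_exp_sum chi (u * d) (?v * ?w)) *
      (D (?u * ?v * ?w) * P (?u * ?v))"
    unfolding 1 3 by (simp only: mult_ac)
  also have "\<dots> = fps_const 2 * fps_exp (?u * ?v * ?w * y) * D (?u * ?v * ?w) ^ 2 *
      (P (?u * ?v) * P (?u * ?w) * P (?v * ?w))"
    unfolding 2 by (simp only: mult_ac power2_eq_square)
  finally show ?thesis .
qed

text \<open>Two adjacent transpositions suffice, as they generate all permutations of
  \<open>u\<close>, \<open>v\<close>, \<open>w\<close>.\<close>

lemma euler_sum_product_symmetric:
  fixes chi :: "int \<Rightarrow> 'a::field_char_0"
  assumes per: "\<And>a. chi (a + int d) = chi a"
    and odd: "odd d" "odd u" "odd v" "odd w"
  shows "euler_sum_product d chi y u v w = euler_sum_product d chi y u w v"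
    and "euler_sum_product d chi y u v w = euler_sum_product d chi y v u w"
proof -
  let ?D = "\<lambda>c :: 'a. fps_exp (of_nat d * c) + 1"
  let ?Q = "?D (of_nat u * of_nat v) * ?D (of_nat u * of_nat w) * ?D (of_nat v * of_nat w)"
  \<comment> \<open>The constant coefficient is 2, nonzero in characteristic 0. Power series over a
    field form an integral domain, so \<open>?Q\<close> can be cancelled.\<close>
  have "?D c \<noteq> 0" for c
  proof
    assume "?D c = 0"
    then have "fps_nth (?D c) 0 = 0" by simp
    then show False by simp
  qed
  then have Q: "?Q \<noteq> 0"
    by simp
  note form = euler_sum_product_symmetric_form[of chi d, OF per \<open>odd d\<close>]
  have "?Q * euler_sum_product d chi y u v w = ?Q * euler_sum_product d chi y u w v"
    using form[of u w v y] form[of u v w y] odd by (simp only: mult_ac simp_thms)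
  with Q show "euler_sum_product d chi y u v w = euler_sum_product d chi y u w v"
    by (simp only: mult_cancel_left simp_thms)
  have "?Q * euler_sum_product d chi y u v w = ?Q * euler_sum_product d chi y v u w"
    using form[of u w v y] form[of v w u y] odd by (simp only: mult_ac simp_thms)
  with Q show "euler_sum_product d chi y u v w = euler_sum_product d chi y v u w"
    by (simp only: mult_cancel_left simp_thms)
qed

theorem theorem4p5:
  fixes p d w1 w2 w3 n :: nat
    and chi0 :: "int \<Rightarrow> complex"
    and \<iota> :: "complex \<Rightarrow> 'a::{field_char_0, complete_space}"
    and chi :: "int \<Rightarrow> 'a"
    and y1 :: 'a
  assumes "prime p" and "odd p"
    and "padic_complex_field p TYPE('a)"
    and "d > 0" and "odd d"
    and "primitive_dirichlet_character d chi0"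
    and "\<forall>a. algebraic (chi0 a)"
    and "algebraic_embedding \<iota>"
    and "chi = \<iota> \<circ> chi0"
    and "w1 > 0" and "odd w1"
    and "w2 > 0" and "odd w2"
    and "w3 > 0" and "odd w3"
    and "y1 \<in> padic_integers"
  shows "let S = (\<lambda>u v w :: nat.
             of_nat u ^ n *
             (\<Sum>k = 0..n. of_nat (n choose k) *
                (\<Sum>a = 0..u * d - 1. (-1) ^ a * chi (int a) *
                   poly (gen_euler_poly d chi k) (of_nat v * y1 + of_nat v / of_nat u * of_nat a)) *
                alt_power_sum (n - k) (w * d - 1) chi * of_nat v ^ (n - k) * of_nat w ^ k))
         in S w1 w2 w3 = S w1 w3 w2 \<and>
            S w1 w3 w2 = S w2 w1 w3 \<and>
            S w2 w1 w3 = S w2 w3 w1 \<and>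
            S w2 w3 w1 = S w3 w1 w2 \<and>
            S w3 w1 w2 = S w3 w2 w1"
proof -
  have per: "chi (a + int d) = chi a" for a
    using assms by (simp add: primitive_dirichlet_character_def dirichlet_character_def)
  note sym = euler_sum_product_symmetric[of chi d, OF per \<open>odd d\<close>]
  \<comment> \<open>Reversed, this rewrites each of the six expressions into \<open>fact n\<close>
    times a coefficient.\<close>
  note nth = fact_mult_euler_sum_product_nth[OF \<open>d > 0\<close>, symmetric]
  have pos: "w1 > 0" "w2 > 0" "w3 > 0"
    by fact+
  have odd: "odd w1" "odd w2" "odd w3"
    by fact+
  \<comment> \<open>Five transpositions connect all six orderings of \<open>w1\<close>,
    \<open>w2\<close>, \<open>w3\<close>.\<close>
  have "euler_sum_product d chi y1 w1 w2 w3 = euler_sum_product d chi y1 w1 w3 w2"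
    by (rule sym(1)[OF odd(1,2,3)])
  moreover have "euler_sum_product d chi y1 w1 w2 w3 = euler_sum_product d chi y1 w2 w1 w3"
    by (rule sym(2)[OF odd(1,2,3)])
  moreover have "euler_sum_product d chi y1 w2 w1 w3 = euler_sum_product d chi y1 w2 w3 w1"
    by (rule sym(1)[OF odd(2,1,3)])
  moreover have "euler_sum_product d chi y1 w1 w3 w2 = euler_sum_product d chi y1 w3 w1 w2"
    by (rule sym(2)[OF odd(1,3,2)])
  moreover have "euler_sum_product d chi y1 w3 w1 w2 = euler_sum_product d chi y1 w3 w2 w1"
    by (rule sym(1)[OF odd(3,1,2)])
  ultimately show ?thesis
    unfolding Let_def nth[OF pos(1) pos(3)] nth[OF pos(1) pos(2)] nth[OF pos(2) pos(3)]
      nth[OF pos(2) pos(1)] nth[OF pos(3) pos(2)] nth[OF pos(3) pos(1)]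
    by metis
qed

end
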